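(* Let $M$ be a monoid. The action functors $D\colon smod\text{-}SExt_M\to \mathcal{S}mod_M$ and $d\colon cc\text{-}SExt_M\to \mathcal{S}mod_M$, both given by $\mathbb{E}\mapsto (K,\eta)$ on objects and $(\alpha_1,\alpha)\mapsto\alpha_1$ on morphisms, are conservative (i.e. they reflect isomorphisms).
   Context: Monoids $K,X$ are written additively ($X$ is not assumed commutative) and $M$ multiplicatively with unit $1$. A monoid extension $\mathbb{E}: K\xrightarrow{k}X\xrightarrow{f}M$ consists of a surjective monoid homomorphism $f$ and a kernel $(K,k)$ of $f$ (so $k$ is injective with image $\{x: f(x)=1\}$). For $m\in M$, the set of representatives of $m$ is $B_m=\{u\in f^{-1}(m): \forall x\in f^{-1}(m)\ \exists!\,a\in K,\ x=k(a)+u\}$, and $B(\mathbb{E})=\bigcup_{m}B_m$. $\mathbb{E}$ is a Schreier extension if $B_m\neq\emptyset$ for all $m\in M$. $SExt_M$ is the category of Schreier extensions with fixed codomain $M$; a morphism from $\mathbb{E}$ to $\mathbb{E}': K'\xrightarrow{k'}X'\xrightarrow{f'}M$ is a pair of monoid homomorphisms $(\alpha_1\colon K\to K',\alpha\colon X\to X')$ with $\alpha k=k'\alpha_1$, $f'\alpha=f$ and $\alpha(B(\mathbb{E}))\subseteq B(\mathbb{E}')$. If $K$ is commutative, for $m\in M$, $a\in K$ let $m\ast a$ be the unique element of $K$ with $u+k(a)=k(m\ast a)+u$, where $u\in B_m$ (it does not depend on the choice of $u$). Write $\eta(m)(a)=m\ast a$. When $K$ is moreover cancellative, $\eta$ is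 always a monoid action, i.e. a monoid homomorphism $\eta\colon M\to \mathrm{End}(K)$. $smod\text{-}SExt_M$ is the full subcategory of $SExt_M$ of the extensions with commutative $K$ for which $\eta$ is a monoid action; $cc\text{-}SExt_M$ is the full subcategory of those with $K$ commutative and cancellative. $\mathcal{S}mod_M$ is the category of $M$-semimodules: commutative monoids $K$ with a monoid homomorphism $\eta\colon M\to\mathrm{End}(K)$; morphisms are the monoid homomorphisms $h\colon K\to K'$ with $h(\eta(m)(a))=\eta'(m)(h(a))$. *)

theory Defs
  imports "HOL-Algebra.Divisibility"
begin

section \<open>Categories, isomorphisms and conservative functors\<close>

text \<open>Composition is in applicative order: for \<open>f\<close> from \<open>x\<close> to \<open>y\<close> and \<open>g\<close> from \<open>y\<close> to \<open>z\<close>,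
  \<open>Comp C x y z g f\<close> is the composite from \<open>x\<close> to \<open>z\<close>. Hom-sets need not be disjoint, so
  composition and the arrow map of a functor take the objects as arguments.\<close>

record ('o, 'a) category =
  Obj :: "'o set"
  Hom :: "'o \<Rightarrow> 'o \<Rightarrow> 'a set"
  Id :: "'o \<Rightarrow> 'a"
  Comp :: "'o \<Rightarrow> 'o \<Rightarrow> 'o \<Rightarrow> 'a \<Rightarrow> 'a \<Rightarrow> 'a"

locale category =
  fixes C :: "('o, 'a) category"
  assumes Id_in_Hom: "x \<in> Obj C \<Longrightarrow> Id C x \<in> Hom C x x"
    and Comp_in_Hom: "\<lbrakk>x \<in> Obj C; y \<in> Obj C; z \<in> Obj C; f \<in> Hom C x y; g \<in> Hom C y z\<rbrakk>
      \<Longrightarrow> Comp C x y z g f \<in> Hom C x z"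
    and Comp_Id_right: "\<lbrakk>x \<in> Obj C; y \<in> Obj C; f \<in> Hom C x y\<rbrakk> \<Longrightarrow> Comp C x x y f (Id C x) = f"
    and Comp_Id_left: "\<lbrakk>x \<in> Obj C; y \<in> Obj C; f \<in> Hom C x y\<rbrakk> \<Longrightarrow> Comp C x y y (Id C y) f = f"
    and Comp_assoc: "\<lbrakk>w \<in> Obj C; x \<in> Obj C; y \<in> Obj C; z \<in> Obj C;
        f \<in> Hom C w x; g \<in> Hom C x y; h \<in> Hom C y z\<rbrakk>
      \<Longrightarrow> Comp C w x z (Comp C x y z h g) f = Comp C w y z h (Comp C w x y g f)"

definition is_iso :: "('o, 'a) category \<Rightarrow> 'o \<Rightarrow> 'o \<Rightarrow> 'a \<Rightarrow> bool" where
  "is_iso C x y f \<longleftrightarrow> f \<in> Hom C x y \<and>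
     (\<exists>g \<in> Hom C y x. Comp C x y x g f = Id C x \<and> Comp C y x y f g = Id C y)"

definition full_subcategory :: "('o, 'a) category \<Rightarrow> ('o \<Rightarrow> bool) \<Rightarrow> ('o, 'a) category" where
  "full_subcategory C P = C\<lparr>Obj := {x \<in> Obj C. P x}\<rparr>"

locale cat_functor = C: category C + D: category D
  for C :: "('o, 'a) category" and D :: "('p, 'b) category" +
  fixes Fobj :: "'o \<Rightarrow> 'p" and Farr :: "'o \<Rightarrow> 'o \<Rightarrow> 'a \<Rightarrow> 'b"
  assumes Fobj_in_Obj: "x \<in> Obj C \<Longrightarrow> Fobj x \<in> Obj D"
    and Farr_in_Hom: "\<lbrakk>x \<in> Obj C; y \<in> Obj C; f \<in> Hom C x y\<rbrakk>
      \<Longrightarrow> Farr x y f \<in> Hom D (Fobj x) (Fobj y)"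
    and Farr_Id: "x \<in> Obj C \<Longrightarrow> Farr x x (Id C x) = Id D (Fobj x)"
    and Farr_Comp: "\<lbrakk>x \<in> Obj C; y \<in> Obj C; z \<in> Obj C; f \<in> Hom C x y; g \<in> Hom C y z\<rbrakk>
      \<Longrightarrow> Farr x z (Comp C x y z g f)
          = Comp D (Fobj x) (Fobj y) (Fobj z) (Farr y z g) (Farr x y f)"

locale conservative_functor = cat_functor +
  assumes reflects_iso: "\<lbrakk>x \<in> Obj C; y \<in> Obj C; f \<in> Hom C x y;
      is_iso D (Fobj x) (Fobj y) (Farr x y f)\<rbrakk> \<Longrightarrow> is_iso C x y f"

section \<open>Monoid homomorphisms and endomorphism monoids\<close>

text \<open>Elements of \<open>hom G H\<close> need not preserve the unit when \<open>G\<close> and \<open>H\<close> are only monoids.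
  Homomorphisms are extensional so that equality of functions is equality on the carrier.\<close>

definition monoid_hom :: "'a monoid \<Rightarrow> 'b monoid \<Rightarrow> ('a \<Rightarrow> 'b) set" where
  "monoid_hom G H = {h \<in> hom G H \<inter> extensional (carrier G). h \<one>\<^bsub>G\<^esub> = \<one>\<^bsub>H\<^esub>}"

definition End :: "'a monoid \<Rightarrow> ('a \<Rightarrow> 'a) monoid" where
  "End G = \<lparr>carrier = monoid_hom G G, mult = compose (carrier G), one = (\<lambda>x \<in> carrier G. x)\<rparr>"

section \<open>Schreier extensions\<close>

text \<open>All monoids are written multiplicatively as in \<open>HOL-Algebra\<close>, including the kernel and the
  middle monoid of an extension, for which additive notation is common.\<close>

record ('k, 'x, 'm) extension =
  Ker :: "'k monoid"
  Mid :: "'x monoid"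
  incl :: "'k \<Rightarrow> 'x"
  proj :: "'x \<Rightarrow> 'm"

definition monoid_extension :: "'m monoid \<Rightarrow> ('k, 'x, 'm) extension \<Rightarrow> bool" where
  "monoid_extension M E \<longleftrightarrow> monoid (Ker E) \<and> monoid (Mid E)
     \<and> proj E \<in> monoid_hom (Mid E) M \<and> proj E ` carrier (Mid E) = carrier M
     \<and> incl E \<in> monoid_hom (Ker E) (Mid E) \<and> inj_on (incl E) (carrier (Ker E))
     \<and> incl E ` carrier (Ker E) = {x \<in> carrier (Mid E). proj E x = \<one>\<^bsub>M\<^esub>}"

definition fibre :: "('k, 'x, 'm) extension \<Rightarrow> 'm \<Rightarrow> 'x set" where
  "fibre E m = {x \<in> carrier (Mid E). proj E x = m}"

definition representatives :: "('k, 'x, 'm) extension \<Rightarrow> 'm \<Rightarrow> 'x set" where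
  "representatives E m = {u \<in> fibre E m.
     \<forall>x \<in> fibre E m. \<exists>!a. a \<in> carrier (Ker E) \<and> x = incl E a \<otimes>\<^bsub>Mid E\<^esub> u}"

definition all_representatives :: "'m monoid \<Rightarrow> ('k, 'x, 'm) extension \<Rightarrow> 'x set" where
  "all_representatives M E = (\<Union>m \<in> carrier M. representatives E m)"

definition schreier_extension :: "'m monoid \<Rightarrow> ('k, 'x, 'm) extension \<Rightarrow> bool" where
  "schreier_extension M E \<longleftrightarrow>
     monoid_extension M E \<and> (\<forall>m \<in> carrier M. representatives E m \<noteq> {})"

definition ext_hom ::
  "'m monoid \<Rightarrow> ('k, 'x, 'm) extension \<Rightarrow> ('k, 'x, 'm) extension \<Rightarrow> (('k \<Rightarrow> 'k) \<times> ('x \<Rightarrow> 'x)) set"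
  where
  "ext_hom M E E' = {(\<alpha>1, \<alpha>). \<alpha>1 \<in> monoid_hom (Ker E) (Ker E') \<and> \<alpha> \<in> monoid_hom (Mid E) (Mid E')
     \<and> (\<forall>a \<in> carrier (Ker E). \<alpha> (incl E a) = incl E' (\<alpha>1 a))
     \<and> (\<forall>x \<in> carrier (Mid E). proj E' (\<alpha> x) = proj E x)
     \<and> \<alpha> ` all_representatives M E \<subseteq> all_representatives M E'}"

definition SExt ::
  "'m monoid \<Rightarrow> (('k, 'x, 'm) extension, ('k \<Rightarrow> 'k) \<times> ('x \<Rightarrow> 'x)) category" where
  "SExt M = \<lparr>
     Obj = {E. schreier_extension M E},
     Hom = ext_hom M,
     Id = (\<lambda>E. (\<lambda>a \<in> carrier (Ker E). a, \<lambda>x \<in> carrier (Mid E). x)),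
     Comp = (\<lambda>E E' E'' (\<beta>1, \<beta>) (\<alpha>1, \<alpha>).
       (compose (carrier (Ker E)) \<beta>1 \<alpha>1, compose (carrier (Mid E)) \<beta> \<alpha>))\<rparr>"

section \<open>The induced action\<close>

text \<open>For a Schreier extension with commutative kernel, the element \<open>b\<close> below exists, is unique and
  does not depend on the representative \<open>u\<close> of \<open>m\<close>.\<close>

definition ext_action :: "'m monoid \<Rightarrow> ('k, 'x, 'm) extension \<Rightarrow> 'm \<Rightarrow> 'k \<Rightarrow> 'k" where
  "ext_action M E = (\<lambda>m \<in> carrier M. \<lambda>a \<in> carrier (Ker E).
     THE b. b \<in> carrier (Ker E) \<and>
       (\<exists>u \<in> representatives E m. u \<otimes>\<^bsub>Mid E\<^esub> incl E a = incl E b \<otimes>\<^bsub>Mid E\<^esub> u))"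

definition smod_SExt ::
  "'m monoid \<Rightarrow> (('k, 'x, 'm) extension, ('k \<Rightarrow> 'k) \<times> ('x \<Rightarrow> 'x)) category" where
  "smod_SExt M = full_subcategory (SExt M)
     (\<lambda>E. comm_monoid (Ker E) \<and> ext_action M E \<in> monoid_hom M (End (Ker E)))"

definition cc_SExt ::
  "'m monoid \<Rightarrow> (('k, 'x, 'm) extension, ('k \<Rightarrow> 'k) \<times> ('x \<Rightarrow> 'x)) category" where
  "cc_SExt M = full_subcategory (SExt M) (\<lambda>E. comm_monoid_cancel (Ker E))"

section \<open>Semimodules and the action functor\<close>

definition Smod :: "'m monoid \<Rightarrow> ('k monoid \<times> ('m \<Rightarrow> 'k \<Rightarrow> 'k), 'k \<Rightarrow> 'k) category" where
  "Smod M = \<lparr>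
     Obj = {(K, \<eta>). comm_monoid K \<and> \<eta> \<in> monoid_hom M (End K)},
     Hom = (\<lambda>(K, \<eta>) (K', \<eta>'). {h \<in> monoid_hom K K'.
       \<forall>m \<in> carrier M. \<forall>a \<in> carrier K. h (\<eta> m a) = \<eta>' m (h a)}),
     Id = (\<lambda>(K, \<eta>). \<lambda>a \<in> carrier K. a),
     Comp = (\<lambda>(K, \<eta>) _ _ g h. compose (carrier K) g h)\<rparr>"

definition action_obj ::
  "'m monoid \<Rightarrow> ('k, 'x, 'm) extension \<Rightarrow> 'k monoid \<times> ('m \<Rightarrow> 'k \<Rightarrow> 'k)" where
  "action_obj M E = (Ker E, ext_action M E)"

definition action_arr ::
  "('k, 'x, 'm) extension \<Rightarrow> ('k, 'x, 'm) extension \<Rightarrow> ('k \<Rightarrow> 'k) \<times> ('x \<Rightarrow> 'x) \<Rightarrow> ('k \<Rightarrow> 'k)" where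
  "action_arr E E' = (\<lambda>(\<alpha>1, \<alpha>). \<alpha>1)"

end

theory Submission imports Defs begin

text \<open>Fix \<open>u \<in> B\<^sub>m\<close>. Then \<open>a \<mapsto> k(a) + u\<close> is a bijection from \<open>K\<close> onto the fibre of \<open>m\<close>, and a
  morphism \<open>(\<alpha>\<^sub>1, \<alpha>)\<close> sends \<open>k(a) + u\<close> to \<open>k'(\<alpha>\<^sub>1 a) + \<alpha>(u)\<close> with \<open>\<alpha>(u) \<in> B'\<^sub>m\<close>. Hence, if \<open>\<alpha>\<^sub>1\<close> is
  bijective, so is \<open>\<alpha>\<close> on each fibre, and it then also reflects representatives.\<close>

section \<open>Monoid homomorphisms\<close>

lemma monoid_hom_iff:
  "h \<in> monoid_hom G H \<longleftrightarrow> h \<in> carrier G \<rightarrow> carrier H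
     \<and> (\<forall>x \<in> carrier G. \<forall>y \<in> carrier G. h (x \<otimes>\<^bsub>G\<^esub> y) = h x \<otimes>\<^bsub>H\<^esub> h y)
     \<and> h \<in> extensional (carrier G) \<and> h \<one>\<^bsub>G\<^esub> = \<one>\<^bsub>H\<^esub>"
  by (auto simp: monoid_hom_def hom_def)

lemma monoid_homD:
  assumes "h \<in> monoid_hom G H"
  shows monoid_hom_closed: "x \<in> carrier G \<Longrightarrow> h x \<in> carrier H"
    and monoid_hom_mult:
      "\<lbrakk>x \<in> carrier G; y \<in> carrier G\<rbrakk> \<Longrightarrow> h (x \<otimes>\<^bsub>G\<^esub> y) = h x \<otimes>\<^bsub>H\<^esub> h y"
    and monoid_hom_one: "h \<one>\<^bsub>G\<^esub> = \<one>\<^bsub>H\<^esub>"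
    and monoid_hom_extensional: "h \<in> extensional (carrier G)"
  using assms by (auto simp: monoid_hom_iff)

lemma monoid_hom_id: "monoid G \<Longrightarrow> (\<lambda>x \<in> carrier G. x) \<in> monoid_hom G G"
  by (auto simp: monoid_hom_iff monoid.m_closed monoid.one_closed)

lemma monoid_hom_compose:
  "\<lbrakk>monoid G; h \<in> monoid_hom G H; g \<in> monoid_hom H I\<rbrakk>
    \<Longrightarrow> compose (carrier G) g h \<in> monoid_hom G I"
  by (auto simp: monoid_hom_iff compose_def monoid.m_closed monoid.one_closed Pi_iff)

text \<open>Source of the unit laws in both categories: extensionality upgrades agreement on the
  carrier to equality of functions.\<close>

lemma compose_restrict_id:
  assumes "f \<in> extensional A"
  shows "compose A f (\<lambda>x \<in> A. x) = f" and "f \<in> A \<rightarrow> B \<Longrightarrow> compose A (\<lambda>x \<in> B. x) f = f"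
  using assms by (auto simp: compose_def extensional_def Pi_iff fun_eq_iff)

text \<open>Serves the kernel and the middle component alike. Products are respected because
  \<open>h\<close> maps \<open>g x \<otimes> g y\<close> to \<open>x \<otimes> y\<close> and
  \<open>g\<close> undoes \<open>h\<close>; \<open>inv_into\<close> is restricted to the carrier so
  that \<open>g\<close> is extensional.\<close>

lemma monoid_hom_inverse:
  assumes "monoid G" and h: "h \<in> monoid_hom G H"
    and bij: "bij_betw h (carrier G) (carrier H)"
  defines "g \<equiv> \<lambda>y \<in> carrier H. inv_into (carrier G) h y"
  shows "g \<in> monoid_hom H G"
    and "compose (carrier G) g h = (\<lambda>x \<in> carrier G. x)"
    and "compose (carrier H) h g = (\<lambda>y \<in> carrier H. y)"
proof -
  have gh: "g (h x) = x" if "x \<in> carrier G" for x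
    using that bij_betw_inv_into_left[OF bij that] monoid_hom_closed[OF h that] by (simp add: g_def)
  have hg: "h (g y) = y" "g y \<in> carrier G" if "y \<in> carrier H" for y
    using that bij_betw_inv_into_right[OF bij that] bij
    by (auto simp: g_def bij_betw_def intro: inv_into_into)
  have "g (x \<otimes>\<^bsub>H\<^esub> y) = g x \<otimes>\<^bsub>G\<^esub> g y" if "x \<in> carrier H" "y \<in> carrier H" for x y
    using gh[of "g x \<otimes>\<^bsub>G\<^esub> g y"] that assms(1) hg monoid_hom_mult[OF h] by (simp add: monoid.m_closed)
  moreover have "g \<one>\<^bsub>H\<^esub> = \<one>\<^bsub>G\<^esub>"
    using gh[of "\<one>\<^bsub>G\<^esub>"] assms(1) monoid_hom_one[OF h] by (simp add: monoid.one_closed)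
  ultimately show "g \<in> monoid_hom H G"
    using hg by (auto simp: monoid_hom_iff) (simp add: g_def)
  show "compose (carrier G) g h = (\<lambda>x \<in> carrier G. x)"
    by (auto simp: compose_def gh)
  show "compose (carrier H) h g = (\<lambda>y \<in> carrier H. y)"
    by (auto simp: compose_def hg)
qed

text \<open>Turns a categorical isomorphism into a bijection of carriers: the two identities,
  evaluated at points of the carriers, make \<open>g\<close> a two-sided inverse there.\<close>

lemma bij_betw_if_compose_id:
  assumes "f \<in> A \<rightarrow> B" "g \<in> B \<rightarrow> A"
    and "compose A g f = (\<lambda>x \<in> A. x)" "compose B f g = (\<lambda>x \<in> B. x)"
  shows "bij_betw f A B"
proof (rule bij_betw_byWitness)
  show "\<forall>a \<in> A. g (f a) = a" "\<forall>b \<in> B. f (g b) = b"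
    using assms(3,4) by (auto simp: compose_def fun_eq_iff) metis+
qed (use assms in auto)

section \<open>The categories of extensions and of semimodules\<close>

lemma category_full_subcategory: "category C \<Longrightarrow> category (full_subcategory C P)"
  unfolding category_def full_subcategory_def by auto

lemma schreier_extensionD:
  assumes "schreier_extension M E"
  shows "monoid (Ker E)" "monoid (Mid E)"
    "proj E \<in> monoid_hom (Mid E) M" "incl E \<in> monoid_hom (Ker E) (Mid E)"
    "inj_on (incl E) (carrier (Ker E))"
    "incl E ` carrier (Ker E) = {x \<in> carrier (Mid E). proj E x = \<one>\<^bsub>M\<^esub>}"
    "m \<in> carrier M \<Longrightarrow> representatives E m \<noteq> {}"
  using assms by (auto simp: schreier_extension_def monoid_extension_def)

lemma all_representatives_subset: "all_representatives M E \<subseteq> carrier (Mid E)"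
  by (auto simp: all_representatives_def representatives_def fibre_def)

lemma ext_hom_id:
  assumes "schreier_extension M E"
  shows "(\<lambda>a \<in> carrier (Ker E). a, \<lambda>x \<in> carrier (Mid E). x) \<in> ext_hom M E E"
  using schreier_extensionD[OF assms] all_representatives_subset[of M E]
    monoid_hom_closed[OF schreier_extensionD(4)[OF assms]]
  by (auto simp: ext_hom_def monoid_hom_id)

lemma ext_hom_compose:
  assumes E: "schreier_extension M E"
    and \<alpha>: "(\<alpha>1, \<alpha>) \<in> ext_hom M E E'" and \<beta>: "(\<beta>1, \<beta>) \<in> ext_hom M E' E''"
  shows "(compose (carrier (Ker E)) \<beta>1 \<alpha>1, compose (carrier (Mid E)) \<beta> \<alpha>) \<in> ext_hom M E E''"
proof -
  \<comment> \<open>Closure facts that allow the restricted composites to be evaluated at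
    \<open>incl E a\<close> and the laws of the second morphism to be applied at
    \<open>\<alpha>1 a\<close> and \<open>\<alpha> x\<close>.\<close>
  have 1: "\<alpha>1 \<in> carrier (Ker E) \<rightarrow> carrier (Ker E')" "\<alpha> \<in> carrier (Mid E) \<rightarrow> carrier (Mid E')"
    "incl E \<in> carrier (Ker E) \<rightarrow> carrier (Mid E)"
    using \<alpha> schreier_extensionD[OF E] by (auto simp: ext_hom_def monoid_hom_iff)
  have "compose (carrier (Mid E)) \<beta> \<alpha> ` all_representatives M E \<subseteq> all_representatives M E''"
    using \<alpha> \<beta> all_representatives_subset[of M E] by (fastforce simp: ext_hom_def compose_def)
  moreover have "compose (carrier (Ker E)) \<beta>1 \<alpha>1 \<in> monoid_hom (Ker E) (Ker E'')"
    "compose (carrier (Mid E)) \<beta> \<alpha> \<in> monoid_hom (Mid E) (Mid E'')"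
    using \<alpha> \<beta> schreier_extensionD(1,2)[OF E]
    by (auto simp: ext_hom_def intro: monoid_hom_compose)
  ultimately show ?thesis
    using \<alpha> \<beta> 1 by (simp add: ext_hom_def compose_eq Pi_iff)
qed

lemma category_SExt: "category (SExt (M :: 'm monoid))"
proof
  fix x assume "x \<in> Obj (SExt M)"
  then show "Id (SExt M) x \<in> Hom (SExt M) x x"
    by (simp add: SExt_def ext_hom_id)
next
  fix x y z :: "('k, 'x, 'm) extension" and f g
  assume "x \<in> Obj (SExt M)" "f \<in> Hom (SExt M) x y" "g \<in> Hom (SExt M) y z"
  then show "Comp (SExt M) x y z g f \<in> Hom (SExt M) x z"
    by (auto simp: SExt_def ext_hom_compose split: prod.splits)
next
  fix x y :: "('k, 'x, 'm) extension" and f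
  assume "f \<in> Hom (SExt M) x y"
  then show "Comp (SExt M) x x y f (Id (SExt M) x) = f" "Comp (SExt M) x y y (Id (SExt M) y) f = f"
    by (auto simp: SExt_def ext_hom_def monoid_hom_iff compose_restrict_id)
next
  fix w x y z :: "('k, 'x, 'm) extension" and f g h
  assume "f \<in> Hom (SExt M) w x" "g \<in> Hom (SExt M) x y" "h \<in> Hom (SExt M) y z"
  then show "Comp (SExt M) w x z (Comp (SExt M) x y z h g) f
      = Comp (SExt M) w y z h (Comp (SExt M) w x y g f)"
    by (auto simp: SExt_def ext_hom_def monoid_hom_iff compose_def Pi_iff)
qed

lemma category_Smod: "category (Smod (M :: 'm monoid))"
proof
  fix x assume "x \<in> Obj (Smod M)"
  then show "Id (Smod M) x \<in> Hom (Smod M) x x"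
    by (auto simp: Smod_def monoid_hom_id comm_monoid.axioms)
      (auto simp: monoid_hom_iff End_def Pi_iff)
next
  fix x y z :: "'k monoid \<times> ('m \<Rightarrow> 'k \<Rightarrow> 'k)" and f g
  assume x: "x \<in> Obj (Smod M)" and f: "f \<in> Hom (Smod M) x y" and g: "g \<in> Hom (Smod M) y z"
  obtain K \<eta> K' \<eta>' K'' \<eta>'' where xyz: "x = (K, \<eta>)" "y = (K', \<eta>')" "z = (K'', \<eta>'')"
    by (cases x, cases y, cases z)
  \<comment> \<open>Needed to evaluate the restricted composite at \<open>\<eta> m a\<close>;
    equivariance of \<open>f\<close> and then of \<open>g\<close> applies afterwards.\<close>
  have closed: "\<eta> m a \<in> carrier K" if "m \<in> carrier M" "a \<in> carrier K" for m a
    using that x by (auto simp: xyz Smod_def monoid_hom_iff End_def Pi_iff)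
  have "monoid K"
    using x by (auto simp: xyz Smod_def comm_monoid.axioms)
  then have "compose (carrier K) g f \<in> monoid_hom K K''"
    using f g by (auto simp: xyz Smod_def intro: monoid_hom_compose)
  then show "Comp (Smod M) x y z g f \<in> Hom (Smod M) x z"
    using f g closed by (auto simp: xyz Smod_def compose_def monoid_hom_closed)
next
  fix x y :: "'k monoid \<times> ('m \<Rightarrow> 'k \<Rightarrow> 'k)" and f
  assume "f \<in> Hom (Smod M) x y"
  then show "Comp (Smod M) x x y f (Id (Smod M) x) = f" "Comp (Smod M) x y y (Id (Smod M) y) f = f"
    by (auto simp: Smod_def monoid_hom_iff compose_restrict_id split: prod.splits)
next
  fix w x y z :: "'k monoid \<times> ('m \<Rightarrow> 'k \<Rightarrow> 'k)" and f g h
  assume "f \<in> Hom (Smod M) w x" "g \<in> Hom (Smod M) x y" "h \<in> Hom (Smod M) y z"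
  then show "Comp (Smod M) w x z (Comp (Smod M) x y z h g) f
      = Comp (Smod M) w y z h (Comp (Smod M) w x y g f)"
    by (auto simp: Smod_def monoid_hom_iff compose_def Pi_iff split: prod.splits)
qed

section \<open>Representatives and the induced action\<close>

locale schreier =
  fixes M :: "'m monoid" and E :: "('k, 'x, 'm) extension"
  assumes monoid_M: "monoid M" and schreier: "schreier_extension M E"
begin

sublocale M: monoid M by (rule monoid_M)
sublocale K: monoid "Ker E" by (rule schreier_extensionD(1)[OF schreier])
sublocale X: monoid "Mid E" by (rule schreier_extensionD(2)[OF schreier])

lemmas proj_hom = schreier_extensionD(3)[OF schreier]
lemmas incl_hom = schreier_extensionD(4)[OF schreier]

lemma incl_closed [simp]: "a \<in> carrier (Ker E) \<Longrightarrow> incl E a \<in> carrier (Mid E)"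
  by (rule monoid_hom_closed[OF incl_hom])

lemma proj_closed [simp]: "x \<in> carrier (Mid E) \<Longrightarrow> proj E x \<in> carrier M"
  by (rule monoid_hom_closed[OF proj_hom])

lemma proj_incl [simp]: "a \<in> carrier (Ker E) \<Longrightarrow> proj E (incl E a) = \<one>\<^bsub>M\<^esub>"
  using schreier_extensionD(6)[OF schreier] by blast

lemmas incl_mult = monoid_hom_mult[OF incl_hom]
lemmas incl_one = monoid_hom_one[OF incl_hom]
lemmas proj_mult = monoid_hom_mult[OF proj_hom]

lemma rep_closed: "u \<in> representatives E m \<Longrightarrow> u \<in> carrier (Mid E)"
  and proj_rep: "u \<in> representatives E m \<Longrightarrow> proj E u = m"
  by (auto simp: representatives_def fibre_def)

text \<open>Distinct fibres are disjoint, so an element can represent only its own image under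
  \<open>proj E\<close>.\<close>

lemma all_rep_iff: "u \<in> all_representatives M E \<longleftrightarrow> u \<in> representatives E (proj E u)"
  unfolding all_representatives_def UN_iff using proj_closed[OF rep_closed] proj_rep by metis

lemma rep_ex1:
  assumes "u \<in> representatives E m" "x \<in> carrier (Mid E)" "proj E x = m"
  shows "\<exists>!a. a \<in> carrier (Ker E) \<and> x = incl E a \<otimes>\<^bsub>Mid E\<^esub> u"
  using assms unfolding representatives_def fibre_def by blast

lemma rep_decomp:
  assumes "u \<in> representatives E m" "x \<in> carrier (Mid E)" "proj E x = m"
  obtains a where "a \<in> carrier (Ker E)" "x = incl E a \<otimes>\<^bsub>Mid E\<^esub> u"
  using rep_ex1[OF assms] that by blast

lemma rep_ex:
  assumes "x \<in> carrier (Mid E)"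
  obtains u a where "u \<in> representatives E (proj E x)" "a \<in> carrier (Ker E)"
    "x = incl E a \<otimes>\<^bsub>Mid E\<^esub> u"
proof -
  obtain u where u: "u \<in> representatives E (proj E x)"
    using schreier_extensionD(7)[OF schreier proj_closed[OF assms]] by blast
  show thesis
    using rep_decomp[OF u assms refl] that[OF u] .
qed

text \<open>The uniqueness half of the notion of representative, used as right cancellation of
  \<open>u\<close> against coefficients from the kernel.\<close>

lemma rep_cancel:
  assumes u: "u \<in> representatives E m" and "a \<in> carrier (Ker E)" "b \<in> carrier (Ker E)"
    and "incl E a \<otimes>\<^bsub>Mid E\<^esub> u = incl E b \<otimes>\<^bsub>Mid E\<^esub> u"
  shows "a = b"
proof -
  \<comment> \<open>As the projection of \<open>u\<close>, \<open>m\<close> lies in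
    \<open>M\<close>; multiplying it by the trivial projection of \<open>incl E a\<close> therefore
    gives \<open>m\<close> again, and the product stays in the fibre.\<close>
  have "m \<in> carrier M"
    using proj_closed[OF rep_closed[OF u]] proj_rep[OF u] by simp
  then have "proj E (incl E a \<otimes>\<^bsub>Mid E\<^esub> u) = m"
    using assms(2) rep_closed[OF u] proj_rep[OF u] by (simp add: proj_mult)
  then show ?thesis
    using rep_ex1[OF u, of "incl E a \<otimes>\<^bsub>Mid E\<^esub> u"] assms(2-4) rep_closed[OF u]
    by (metis X.m_closed incl_closed)
qed

text \<open>The fibre of the unit is the image of the injective map \<open>k\<close>, so each of its
  elements is \<open>k(a) + 0\<close> for exactly one \<open>a\<close>. This representative is used
  to compute the action of the unit of \<open>M\<close>.\<close>

lemma one_representative: "\<one>\<^bsub>Mid E\<^esub> \<in> representatives E \<one>\<^bsub>M\<^esub>"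
proof -
  have "\<exists>!a. a \<in> carrier (Ker E) \<and> x = incl E a \<otimes>\<^bsub>Mid E\<^esub> \<one>\<^bsub>Mid E\<^esub>"
    if "x \<in> carrier (Mid E)" "proj E x = \<one>\<^bsub>M\<^esub>" for x
  proof -
    have "x \<in> incl E ` carrier (Ker E)"
      unfolding schreier_extensionD(6)[OF schreier] using that by simp
    then obtain a where a: "a \<in> carrier (Ker E)" "x = incl E a"
      by blast
    show ?thesis
    proof (rule ex1I)
      show "a \<in> carrier (Ker E) \<and> x = incl E a \<otimes>\<^bsub>Mid E\<^esub> \<one>\<^bsub>Mid E\<^esub>"
        using a by simp
      show "b = a" if "b \<in> carrier (Ker E) \<and> x = incl E b \<otimes>\<^bsub>Mid E\<^esub> \<one>\<^bsub>Mid E\<^esub>" for b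
        using inj_onD[OF schreier_extensionD(5)[OF schreier], of b a] that a by auto
    qed
  qed
  then show ?thesis
    using monoid_hom_one[OF proj_hom] X.one_closed
    unfolding representatives_def fibre_def by blast
qed

end

section \<open>The action on a commutative kernel\<close>

locale comm_schreier = schreier +
  assumes comm: "comm_monoid (Ker E)"
begin

sublocale K: comm_monoid "Ker E" by (rule comm)

text \<open>Independence of the representative: any \<open>v\<close> over \<open>m\<close> is
  \<open>k(d) + u\<close>, and commutativity of the kernel exchanges \<open>d\<close> and
  \<open>b\<close>, so \<open>v\<close> yields the same coefficient \<open>b\<close>. The action can
  thus be computed from any convenient \<open>u\<close>.\<close>

lemma ext_action_eqI:
  assumes m: "m \<in> carrier M" and a: "a \<in> carrier (Ker E)" and b: "b \<in> carrier (Ker E)"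
    and u: "u \<in> representatives E m"
    and eq: "u \<otimes>\<^bsub>Mid E\<^esub> incl E a = incl E b \<otimes>\<^bsub>Mid E\<^esub> u"
  shows "ext_action M E m a = b"
proof -
  have "c = b" if c: "c \<in> carrier (Ker E)" and v: "v \<in> representatives E m"
    and veq: "v \<otimes>\<^bsub>Mid E\<^esub> incl E a = incl E c \<otimes>\<^bsub>Mid E\<^esub> v" for c v
  proof -
    obtain d where d: "d \<in> carrier (Ker E)" "v = incl E d \<otimes>\<^bsub>Mid E\<^esub> u"
      using rep_decomp[OF u rep_closed[OF v] proj_rep[OF v]] .
    note closed = a b c d(1) rep_closed[OF u] rep_closed[OF v]
    have "v \<otimes>\<^bsub>Mid E\<^esub> incl E a = incl E d \<otimes>\<^bsub>Mid E\<^esub> (incl E b \<otimes>\<^bsub>Mid E\<^esub> u)"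
      using closed eq by (simp add: d(2) X.m_assoc)
    also have "\<dots> = incl E (d \<otimes>\<^bsub>Ker E\<^esub> b) \<otimes>\<^bsub>Mid E\<^esub> u"
      using closed by (simp add: X.m_assoc incl_mult)
    also have "\<dots> = incl E b \<otimes>\<^bsub>Mid E\<^esub> v"
      using closed by (simp add: K.m_comm[of d b] X.m_assoc incl_mult d(2))
    finally show "c = b"
      using rep_cancel[OF v c b] veq by simp
  qed
  then show ?thesis
    unfolding ext_action_def restrict_apply'[OF m] restrict_apply'[OF a]
    using b u eq by (intro the_equality) blast+
qed

text \<open>Since \<open>k(a)\<close> projects to the unit, \<open>u + k(a)\<close> stays in the
  fibre of \<open>m\<close> and decomposes over \<open>u\<close>; its coefficient is the value of
  the action.\<close>

lemma
  assumes m: "m \<in> carrier M" and a: "a \<in> carrier (Ker E)"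
  shows ext_action_closed: "ext_action M E m a \<in> carrier (Ker E)"
    and rep_incl_commute: "u \<in> representatives E m \<Longrightarrow>
      u \<otimes>\<^bsub>Mid E\<^esub> incl E a = incl E (ext_action M E m a) \<otimes>\<^bsub>Mid E\<^esub> u"
proof -
  have *: "ext_action M E m a \<in> carrier (Ker E) \<and>
      u \<otimes>\<^bsub>Mid E\<^esub> incl E a = incl E (ext_action M E m a) \<otimes>\<^bsub>Mid E\<^esub> u"
    if u: "u \<in> representatives E m" for u
  proof -
    have "u \<otimes>\<^bsub>Mid E\<^esub> incl E a \<in> carrier (Mid E)" "proj E (u \<otimes>\<^bsub>Mid E\<^esub> incl E a) = m"
      using rep_closed[OF u] proj_rep[OF u] m a by (simp_all add: proj_mult)
    then obtain b where b: "b \<in> carrier (Ker E)" "u \<otimes>\<^bsub>Mid E\<^esub> incl E a = incl E b \<otimes>\<^bsub>Mid E\<^esub> u"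
      by (rule rep_decomp[OF u])
    show ?thesis
      unfolding ext_action_eqI[OF m a b(1) u b(2)] using b by blast
  qed
  then show "u \<in> representatives E m \<Longrightarrow>
      u \<otimes>\<^bsub>Mid E\<^esub> incl E a = incl E (ext_action M E m a) \<otimes>\<^bsub>Mid E\<^esub> u"
    by blast
  show "ext_action M E m a \<in> carrier (Ker E)"
    using * schreier_extensionD(7)[OF schreier m] by blast
qed

text \<open>Moving \<open>k(a)\<close> and then \<open>k(b)\<close> to the left past one fixed
  \<open>u\<close> produces the sum of the two values as coefficient; for the unit,
  \<open>u + 0 = 0 + u\<close>.\<close>

lemma ext_action_End:
  assumes m: "m \<in> carrier M"
  shows "ext_action M E m \<in> carrier (End (Ker E))"
proof -
  obtain u where u: "u \<in> representatives E m"
    using schreier_extensionD(7)[OF schreier m] by blast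
  note [simp] = rep_closed[OF u] ext_action_closed[OF m]
  have "ext_action M E m (a \<otimes>\<^bsub>Ker E\<^esub> b) = ext_action M E m a \<otimes>\<^bsub>Ker E\<^esub> ext_action M E m b"
    if ab [simp]: "a \<in> carrier (Ker E)" "b \<in> carrier (Ker E)" for a b
  proof (rule ext_action_eqI[OF m _ _ u])
    have "u \<otimes>\<^bsub>Mid E\<^esub> incl E (a \<otimes>\<^bsub>Ker E\<^esub> b) = u \<otimes>\<^bsub>Mid E\<^esub> incl E a \<otimes>\<^bsub>Mid E\<^esub> incl E b"
      by (simp add: incl_mult X.m_assoc)
    also have "\<dots> = incl E (ext_action M E m a) \<otimes>\<^bsub>Mid E\<^esub> (u \<otimes>\<^bsub>Mid E\<^esub> incl E b)"
      by (simp add: rep_incl_commute[OF m ab(1) u] X.m_assoc)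
    also have "\<dots> = incl E (ext_action M E m a \<otimes>\<^bsub>Ker E\<^esub> ext_action M E m b) \<otimes>\<^bsub>Mid E\<^esub> u"
      by (simp add: rep_incl_commute[OF m ab(2) u] X.m_assoc incl_mult)
    finally show "u \<otimes>\<^bsub>Mid E\<^esub> incl E (a \<otimes>\<^bsub>Ker E\<^esub> b) =
      incl E (ext_action M E m a \<otimes>\<^bsub>Ker E\<^esub> ext_action M E m b) \<otimes>\<^bsub>Mid E\<^esub> u" .
  qed auto
  moreover have "ext_action M E m \<one>\<^bsub>Ker E\<^esub> = \<one>\<^bsub>Ker E\<^esub>"
    by (rule ext_action_eqI[OF m _ _ u]) (auto simp: incl_one)
  ultimately show ?thesis
    using m by (auto simp: End_def monoid_hom_iff) (auto simp: ext_action_def)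
qed

text \<open>The unit of the middle monoid represents the unit of \<open>M\<close> and commutes with
  every \<open>k(a)\<close>, so the coefficient is \<open>a\<close> itself.\<close>

lemma ext_action_one: "ext_action M E \<one>\<^bsub>M\<^esub> = \<one>\<^bsub>End (Ker E)\<^esub>"
proof -
  have "ext_action M E \<one>\<^bsub>M\<^esub> a = a" if "a \<in> carrier (Ker E)" for a
    by (rule ext_action_eqI[OF _ _ _ one_representative]) (use that in auto)
  moreover have "ext_action M E \<one>\<^bsub>M\<^esub> \<in> extensional (carrier (Ker E))"
    by (simp add: ext_action_def)
  ultimately show ?thesis
    by (auto simp: End_def fun_eq_iff extensional_def)
qed

text \<open>With \<open>u + v = k(c) + w\<close>, moving \<open>k(a)\<close> to the left past both sides gives
  \<open>m * (n * a) + c = c + mn * a\<close>, so cancellation is needed.\<close>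
lemma ext_action_mult:
  assumes "comm_monoid_cancel (Ker E)"
    and m: "m \<in> carrier M" and n: "n \<in> carrier M" and a: "a \<in> carrier (Ker E)"
  shows "ext_action M E (m \<otimes>\<^bsub>M\<^esub> n) a = ext_action M E m (ext_action M E n a)"
proof -
  interpret K: comm_monoid_cancel "Ker E" by fact
  have mn: "m \<otimes>\<^bsub>M\<^esub> n \<in> carrier M" using m n by simp
  obtain u v w where uvw: "u \<in> representatives E m" "v \<in> representatives E n"
      "w \<in> representatives E (m \<otimes>\<^bsub>M\<^esub> n)"
    using m n mn by (blast dest: schreier_extensionD(7)[OF schreier])
  note [simp] = uvw[THEN rep_closed] a
  obtain c where c [simp]: "c \<in> carrier (Ker E)" and uv: "u \<otimes>\<^bsub>Mid E\<^esub> v = incl E c \<otimes>\<^bsub>Mid E\<^esub> w"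
  proof (rule rep_decomp[OF uvw(3), of "u \<otimes>\<^bsub>Mid E\<^esub> v"])
    show "proj E (u \<otimes>\<^bsub>Mid E\<^esub> v) = m \<otimes>\<^bsub>M\<^esub> n"
      using uvw[THEN proj_rep] by (simp add: proj_mult)
  qed auto
  define b where "b = ext_action M E n a"
  define d where "d = ext_action M E m b"
  define e where "e = ext_action M E (m \<otimes>\<^bsub>M\<^esub> n) a"
  have b [simp]: "b \<in> carrier (Ker E)" by (simp add: b_def ext_action_closed n)
  have d [simp]: "d \<in> carrier (Ker E)" by (simp add: d_def ext_action_closed m)
  have e [simp]: "e \<in> carrier (Ker E)" by (simp add: e_def ext_action_closed mn)
  have "incl E (d \<otimes>\<^bsub>Ker E\<^esub> c) \<otimes>\<^bsub>Mid E\<^esub> w = incl E d \<otimes>\<^bsub>Mid E\<^esub> (u \<otimes>\<^bsub>Mid E\<^esub> v)"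
    by (simp add: uv incl_mult X.m_assoc)
  also have "\<dots> = (u \<otimes>\<^bsub>Mid E\<^esub> incl E b) \<otimes>\<^bsub>Mid E\<^esub> v"
    by (simp add: rep_incl_commute[OF m b uvw(1)] X.m_assoc flip: d_def)
  also have "\<dots> = u \<otimes>\<^bsub>Mid E\<^esub> (v \<otimes>\<^bsub>Mid E\<^esub> incl E a)"
    by (simp add: rep_incl_commute[OF n a uvw(2)] X.m_assoc flip: b_def)
  also have "\<dots> = incl E c \<otimes>\<^bsub>Mid E\<^esub> (w \<otimes>\<^bsub>Mid E\<^esub> incl E a)"
    by (simp add: uv flip: X.m_assoc)
  also have "\<dots> = incl E (c \<otimes>\<^bsub>Ker E\<^esub> e) \<otimes>\<^bsub>Mid E\<^esub> w"
    by (simp add: rep_incl_commute[OF mn a uvw(3)] X.m_assoc incl_mult flip: e_def)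
  \<comment> \<open>First \<open>w\<close> is removed by uniqueness of coefficients, then
    \<open>c\<close> by cancellation in the kernel.\<close>
  finally have "d \<otimes>\<^bsub>Ker E\<^esub> c = c \<otimes>\<^bsub>Ker E\<^esub> e"
    by (rule rep_cancel[OF uvw(3), rotated -1]) auto
  then have "c \<otimes>\<^bsub>Ker E\<^esub> e = c \<otimes>\<^bsub>Ker E\<^esub> d"
    by (simp add: K.m_comm)
  then have "e = d"
    by (rule K.l_cancel) auto
  then show ?thesis
    by (simp add: b_def d_def e_def)
qed

text \<open>The pointwise law \<open>ext_action_mult\<close> becomes an equation in
  \<open>End (Ker E)\<close> because both sides are restricted to the kernel and agree outside it by
  default.\<close>

lemma ext_action_hom:
  assumes "comm_monoid_cancel (Ker E)"
  shows "ext_action M E \<in> monoid_hom M (End (Ker E))"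
proof -
  have "ext_action M E (m \<otimes>\<^bsub>M\<^esub> n) = compose (carrier (Ker E)) (ext_action M E m) (ext_action M E n)"
    if "m \<in> carrier M" "n \<in> carrier M" for m n
    using that ext_action_mult[OF assms that] by (auto simp: compose_def fun_eq_iff ext_action_def)
  then show ?thesis
    using ext_action_End ext_action_one
    by (auto simp: monoid_hom_iff[of _ M]) (auto simp: End_def ext_action_def)
qed

end

section \<open>Morphisms of extensions\<close>

locale ext_morphism = schreier M E + E': schreier M E'
  for M :: "'m monoid" and E E' :: "('k, 'x, 'm) extension" +
  fixes \<alpha>1 :: "'k \<Rightarrow> 'k" and \<alpha> :: "'x \<Rightarrow> 'x"
  assumes ext_hom: "(\<alpha>1, \<alpha>) \<in> ext_hom M E E'"
begin

lemma ker_hom: "\<alpha>1 \<in> monoid_hom (Ker E) (Ker E')"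
  and mid_hom: "\<alpha> \<in> monoid_hom (Mid E) (Mid E')"
  and mid_incl: "a \<in> carrier (Ker E) \<Longrightarrow> \<alpha> (incl E a) = incl E' (\<alpha>1 a)"
  and proj_mid: "x \<in> carrier (Mid E) \<Longrightarrow> proj E' (\<alpha> x) = proj E x"
  using ext_hom by (auto simp: ext_hom_def)

lemmas ker_closed [simp] = monoid_hom_closed[OF ker_hom]
lemmas mid_closed [simp] = monoid_hom_closed[OF mid_hom]

text \<open>A morphism is only required to map the union of all \<open>B_m\<close> into the union of
  all \<open>B'_m\<close>. As it also commutes with the projections, and a representative lies in
  its own fibre, the index \<open>m\<close> is kept.\<close>

lemma mid_rep:
  assumes "u \<in> representatives E m"
  shows "\<alpha> u \<in> representatives E' m"
proof -
  have "u \<in> all_representatives M E"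
    using assms by (simp add: all_rep_iff proj_rep[OF assms])
  then have "\<alpha> u \<in> all_representatives M E'"
    using ext_hom by (auto simp: ext_hom_def)
  then show ?thesis
    by (simp add: E'.all_rep_iff proj_mid[OF rep_closed[OF assms]] proj_rep[OF assms])
qed

lemma mid_incl_mult:
  "\<lbrakk>a \<in> carrier (Ker E); x \<in> carrier (Mid E)\<rbrakk>
    \<Longrightarrow> \<alpha> (incl E a \<otimes>\<^bsub>Mid E\<^esub> x) = incl E' (\<alpha>1 a) \<otimes>\<^bsub>Mid E'\<^esub> \<alpha> x"
  by (simp add: monoid_hom_mult[OF mid_hom] mid_incl)

text \<open>Applying \<alpha> to \<open>u + k(a) = k(m * a) + u\<close> gives the defining equation
  of the action of the target extension at \<open>\<alpha>1 a\<close>, with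
  \<open>\<alpha> u\<close> as representative.\<close>

lemma ker_equivariant:
  assumes "comm_monoid (Ker E)" "comm_monoid (Ker E')"
    and m: "m \<in> carrier M" and a: "a \<in> carrier (Ker E)"
  shows "\<alpha>1 (ext_action M E m a) = ext_action M E' m (\<alpha>1 a)"
proof -
  interpret E: comm_schreier M E by unfold_locales (rule comm_monoid.m_comm[OF assms(1)])
  interpret E': comm_schreier M E' by unfold_locales (rule comm_monoid.m_comm[OF assms(2)])
  obtain u where u: "u \<in> representatives E m"
    using schreier_extensionD(7)[OF schreier m] by blast
  note closed = rep_closed[OF u] E.ext_action_closed[OF m a]
  have "\<alpha> u \<otimes>\<^bsub>Mid E'\<^esub> incl E' (\<alpha>1 a) = \<alpha> (u \<otimes>\<^bsub>Mid E\<^esub> incl E a)"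
    using closed a by (simp add: monoid_hom_mult[OF mid_hom] mid_incl)
  also have "\<dots> = incl E' (\<alpha>1 (ext_action M E m a)) \<otimes>\<^bsub>Mid E'\<^esub> \<alpha> u"
    using closed by (simp add: E.rep_incl_commute[OF m a u] mid_incl_mult)
  finally show ?thesis
    using E'.ext_action_eqI[OF m ker_closed[OF a] ker_closed[OF closed(2)] mid_rep[OF u]] by metis
qed

section \<open>Morphisms that are bijective on kernels\<close>

context
  assumes bij: "bij_betw \<alpha>1 (carrier (Ker E)) (carrier (Ker E'))"
begin

lemma mid_bij: "bij_betw \<alpha> (carrier (Mid E)) (carrier (Mid E'))"
proof (rule bij_betw_imageI)
  show "inj_on \<alpha> (carrier (Mid E))"
  proof (rule inj_onI)
    fix x y assume x: "x \<in> carrier (Mid E)" and y: "y \<in> carrier (Mid E)" and eq: "\<alpha> x = \<alpha> y"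
    \<comment> \<open>Equal images force equal projections, so \<open>x\<close> and \<open>y\<close>
      decompose over one common representative \<open>u\<close> and only their coefficients have to
      be compared.\<close>
    then have p: "proj E y = proj E x" using proj_mid by metis
    obtain u a where u: "u \<in> representatives E (proj E x)"
      and a: "a \<in> carrier (Ker E)" "x = incl E a \<otimes>\<^bsub>Mid E\<^esub> u"
      using rep_ex[OF x] .
    obtain b where b: "b \<in> carrier (Ker E)" "y = incl E b \<otimes>\<^bsub>Mid E\<^esub> u"
      using rep_decomp[OF u y p] .
    have "incl E' (\<alpha>1 a) \<otimes>\<^bsub>Mid E'\<^esub> \<alpha> u = incl E' (\<alpha>1 b) \<otimes>\<^bsub>Mid E'\<^esub> \<alpha> u"
      using eq a b rep_closed[OF u] by (simp add: mid_incl_mult)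
    then have "\<alpha>1 a = \<alpha>1 b"
      using E'.rep_cancel[OF mid_rep[OF u]] a b by simp
    then show "x = y"
      using a b inj_onD[OF bij_betw_imp_inj_on[OF bij]] by metis
  qed
  show "\<alpha> ` carrier (Mid E) = carrier (Mid E')"
  proof (intro equalityI subsetI)
    fix y assume y: "y \<in> carrier (Mid E')"
    \<comment> \<open>A preimage is sought in the fibre over \<open>proj E' y\<close>: the image of
      a representative \<open>u\<close> there is again a representative, so the coefficient of
      \<open>y\<close> over \<open>\<alpha> u\<close> can be pulled back through
      \<open>\<alpha>1\<close>.\<close>
    obtain u where u: "u \<in> representatives E (proj E' y)"
      using schreier_extensionD(7)[OF schreier E'.proj_closed[OF y]] by blast
    obtain b where b: "b \<in> carrier (Ker E')" "y = incl E' b \<otimes>\<^bsub>Mid E'\<^esub> \<alpha> u"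
      using E'.rep_decomp[OF mid_rep[OF u] y refl] .
    then obtain a where a: "a \<in> carrier (Ker E)" "b = \<alpha>1 a"
      using bij by (auto simp: bij_betw_def)
    then have "y = \<alpha> (incl E a \<otimes>\<^bsub>Mid E\<^esub> u)"
      using b rep_closed[OF u] by (simp add: mid_incl_mult)
    then show "y \<in> \<alpha> ` carrier (Mid E)"
      using a rep_closed[OF u] by simp
  qed auto
qed

text \<open>Needed for the inverse of \<alpha> to preserve representatives. A coefficient of
  \<open>\<alpha> y\<close> over \<open>\<alpha> x\<close> is pulled back through
  \<open>\<alpha>1\<close>, and injectivity of \<alpha> then gives the decomposition of
  \<open>y\<close>; uniqueness is transported along \<alpha> and \<open>\<alpha>1\<close>.\<close>

lemma mid_reflects_rep:
  assumes x: "x \<in> carrier (Mid E)" and rep: "\<alpha> x \<in> representatives E' m"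
  shows "x \<in> representatives E m"
proof -
  have p: "proj E x = m"
    using E'.proj_rep[OF rep] proj_mid[OF x] by simp
  have "\<exists>!a. a \<in> carrier (Ker E) \<and> y = incl E a \<otimes>\<^bsub>Mid E\<^esub> x"
    if y: "y \<in> carrier (Mid E)" "proj E y = m" for y
  proof (rule ex_ex1I)
    obtain b where b: "b \<in> carrier (Ker E')" "\<alpha> y = incl E' b \<otimes>\<^bsub>Mid E'\<^esub> \<alpha> x"
      using E'.rep_decomp[OF rep mid_closed[OF y(1)]] y proj_mid by metis
    then obtain a where a: "a \<in> carrier (Ker E)" "b = \<alpha>1 a"
      using bij by (auto simp: bij_betw_def)
    have "\<alpha> y = \<alpha> (incl E a \<otimes>\<^bsub>Mid E\<^esub> x)"
      using a b x by (simp add: mid_incl_mult)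
    then have "y = incl E a \<otimes>\<^bsub>Mid E\<^esub> x"
      by (rule inj_onD[OF bij_betw_imp_inj_on[OF mid_bij]]) (use x y a in auto)
    then show "\<exists>a. a \<in> carrier (Ker E) \<and> y = incl E a \<otimes>\<^bsub>Mid E\<^esub> x"
      using a by blast
  next
    fix a b
    assume "a \<in> carrier (Ker E) \<and> y = incl E a \<otimes>\<^bsub>Mid E\<^esub> x"
      and "b \<in> carrier (Ker E) \<and> y = incl E b \<otimes>\<^bsub>Mid E\<^esub> x"
    then have ab: "a \<in> carrier (Ker E)" "b \<in> carrier (Ker E)"
      and "\<alpha> (incl E a \<otimes>\<^bsub>Mid E\<^esub> x) = \<alpha> (incl E b \<otimes>\<^bsub>Mid E\<^esub> x)"
      by auto
    then have "incl E' (\<alpha>1 a) \<otimes>\<^bsub>Mid E'\<^esub> \<alpha> x = incl E' (\<alpha>1 b) \<otimes>\<^bsub>Mid E'\<^esub> \<alpha> x"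
      using x by (simp add: mid_incl_mult)
    then have "\<alpha>1 a = \<alpha>1 b"
      using E'.rep_cancel[OF rep] ab by simp
    then show "a = b"
      using ab inj_onD[OF bij_betw_imp_inj_on[OF bij]] by metis
  qed
  then show ?thesis
    using x p unfolding representatives_def fibre_def by blast
qed

text \<open>Compatibility with the inclusions is checked after applying the injective \<alpha>,
  compatibility with the projections by evaluating \<open>proj_mid\<close> at
  \<open>\<beta> y\<close>, and representatives are handled by
  \<open>mid_reflects_rep\<close>.\<close>

lemma ext_hom_inverse:
  defines "\<beta>1 \<equiv> \<lambda>b \<in> carrier (Ker E'). inv_into (carrier (Ker E)) \<alpha>1 b"
    and "\<beta> \<equiv> \<lambda>y \<in> carrier (Mid E'). inv_into (carrier (Mid E)) \<alpha> y"
  shows "(\<beta>1, \<beta>) \<in> ext_hom M E' E"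
proof -
  have \<beta>1: "\<beta>1 \<in> monoid_hom (Ker E') (Ker E)"
    unfolding \<beta>1_def by (rule monoid_hom_inverse(1)[OF K.monoid_axioms ker_hom bij])
  have \<beta>: "\<beta> \<in> monoid_hom (Mid E') (Mid E)"
    unfolding \<beta>_def by (rule monoid_hom_inverse(1)[OF X.monoid_axioms mid_hom mid_bij])
  note [simp] = monoid_hom_closed[OF \<beta>1] monoid_hom_closed[OF \<beta>]
  have inv1: "\<alpha>1 (\<beta>1 b) = b" if "b \<in> carrier (Ker E')" for b
    using that bij_betw_inv_into_right[OF bij] by (simp add: \<beta>1_def)
  have inv: "\<alpha> (\<beta> y) = y" if "y \<in> carrier (Mid E')" for y
    using that bij_betw_inv_into_right[OF mid_bij] by (simp add: \<beta>_def)
  have "\<beta> (incl E' b) = incl E (\<beta>1 b)" if b: "b \<in> carrier (Ker E')" for b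
  proof -
    have "\<alpha> (\<beta> (incl E' b)) = \<alpha> (incl E (\<beta>1 b))"
      using b by (simp add: inv inv1 mid_incl)
    then show ?thesis
      by (rule inj_onD[OF bij_betw_imp_inj_on[OF mid_bij]]) (use b in auto)
  qed
  moreover have "proj E (\<beta> y) = proj E' y" if "y \<in> carrier (Mid E')" for y
    using proj_mid[of "\<beta> y"] that by (simp add: inv)
  moreover have "\<beta> ` all_representatives M E' \<subseteq> all_representatives M E"
  proof clarify
    fix v assume "v \<in> all_representatives M E'"
    then obtain m where m: "m \<in> carrier M" and v: "v \<in> representatives E' m"
      by (auto simp: all_representatives_def)
    have "\<beta> v \<in> representatives E m"
      using mid_reflects_rep[of "\<beta> v"] E'.rep_closed[OF v] v by (simp add: inv)
    then show "\<beta> v \<in> all_representatives M E"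
      using m by (auto simp: all_representatives_def)
  qed
  ultimately show ?thesis
    using \<beta>1 \<beta> by (auto simp: ext_hom_def)
qed

lemma is_iso_SExt: "is_iso (SExt M) E E' (\<alpha>1, \<alpha>)"
  unfolding is_iso_def SExt_def
  using ext_hom
    monoid_hom_inverse(2,3)[OF K.monoid_axioms ker_hom bij]
    monoid_hom_inverse(2,3)[OF X.monoid_axioms mid_hom mid_bij]
  by (auto intro!: bexI[OF _ ext_hom_inverse])

end

end

section \<open>The action functors\<close>

text \<open>Links the hypothesis of conservativity to the bijectivity on kernels from which
  isomorphisms of extensions are built.\<close>

lemma is_iso_Smod_bij:
  assumes "is_iso (Smod M) (K, \<eta>) (K', \<eta>') h"
  shows "bij_betw h (carrier K) (carrier K')"
proof -
  obtain g where "h \<in> monoid_hom K K'" "g \<in> monoid_hom K' K"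
    "compose (carrier K) g h = (\<lambda>a \<in> carrier K. a)"
    "compose (carrier K') h g = (\<lambda>a \<in> carrier K'. a)"
    using assms by (auto simp: is_iso_def Smod_def)
  then show ?thesis
    by (intro bij_betw_if_compose_id[of h _ _ g]) (auto simp: monoid_hom_iff)
qed

text \<open>The predicate \<open>P\<close> treats both subcategories at once; the condition on it
  says that the kernel with its induced action is a semimodule.\<close>

lemma conservative_action_functor:
  fixes P :: "('k, 'x, 'm) extension \<Rightarrow> bool"
  assumes M: "monoid M"
    and P: "\<And>E. \<lbrakk>schreier_extension M E; P E\<rbrakk>
      \<Longrightarrow> comm_monoid (Ker E) \<and> ext_action M E \<in> monoid_hom M (End (Ker E))"
  shows "conservative_functor (full_subcategory (SExt M) P) (Smod M) (action_obj M) action_arr"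
proof -
  interpret S: category "full_subcategory (SExt M) P"
    by (rule category_full_subcategory[OF category_SExt])
  interpret D: category "Smod M" by (rule category_Smod)
  \<comment> \<open>Puts every arrow of the subcategory into the locale of morphisms, so that its
    results apply to the functor obligations.\<close>
  have morphism: "ext_morphism M E E' \<alpha>1 \<alpha>"
    if "E \<in> Obj (full_subcategory (SExt M) P)" "E' \<in> Obj (full_subcategory (SExt M) P)"
      "(\<alpha>1, \<alpha>) \<in> Hom (full_subcategory (SExt M) P) E E'" for E E' \<alpha>1 \<alpha>
    using that M by (auto simp: full_subcategory_def SExt_def ext_morphism_def
        ext_morphism_axioms_def schreier_def)
  show ?thesis
  proof
    fix E assume "E \<in> Obj (full_subcategory (SExt M) P)"
    then show "action_obj M E \<in> Obj (Smod M)"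
      using P by (auto simp: full_subcategory_def SExt_def Smod_def action_obj_def)
  next
    fix E E' f
    assume f: "E \<in> Obj (full_subcategory (SExt M) P)" "E' \<in> Obj (full_subcategory (SExt M) P)"
      "f \<in> Hom (full_subcategory (SExt M) P) E E'"
    obtain \<alpha>1 \<alpha> where \<alpha>: "f = (\<alpha>1, \<alpha>)" by (cases f)
    interpret ext_morphism M E E' \<alpha>1 \<alpha> using f by (intro morphism) (auto simp: \<alpha>)
    have "comm_monoid (Ker E)" "comm_monoid (Ker E')"
      using f P by (auto simp: full_subcategory_def SExt_def)
    then show "action_arr E E' f \<in> Hom (Smod M) (action_obj M E) (action_obj M E')"
      using ker_hom ker_equivariant by (auto simp: \<alpha> action_arr_def action_obj_def Smod_def)
    \<comment> \<open>Reflection of isomorphisms is proved in the same block as the arrow condition,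
      since both concern one interpreted morphism.\<close>
    assume "is_iso (Smod M) (action_obj M E) (action_obj M E') (action_arr E E' f)"
    then have "bij_betw \<alpha>1 (carrier (Ker E)) (carrier (Ker E'))"
      by (auto simp: \<alpha> action_arr_def action_obj_def dest: is_iso_Smod_bij)
    then have "is_iso (SExt M) E E' f"
      by (simp add: \<alpha> is_iso_SExt)
    \<comment> \<open>By fullness, the inverse found in \<open>SExt M\<close> is already an arrow of
      the subcategory.\<close>
    then show "is_iso (full_subcategory (SExt M) P) E E' f"
      by (simp add: is_iso_def full_subcategory_def)
  next
    fix E
    show "action_arr E E (Id (full_subcategory (SExt M) P) E) = Id (Smod M) (action_obj M E)"
      by (simp add: full_subcategory_def SExt_def Smod_def action_arr_def action_obj_def)
  next
    fix E E' E'' f g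
    show "action_arr E E'' (Comp (full_subcategory (SExt M) P) E E' E'' g f)
        = Comp (Smod M) (action_obj M E) (action_obj M E') (action_obj M E'')
            (action_arr E' E'' g) (action_arr E E' f)"
      by (simp add: full_subcategory_def SExt_def Smod_def action_arr_def action_obj_def
          split: prod.splits)
  qed
qed

theorem proposition7p1:
  fixes M :: "'m monoid"
  assumes "monoid M"
  shows "conservative_functor
           (smod_SExt M :: (('k, 'x, 'm) extension, ('k \<Rightarrow> 'k) \<times> ('x \<Rightarrow> 'x)) category)
           (Smod M) (action_obj M) action_arr
       \<and> conservative_functor
           (cc_SExt M :: (('k, 'x, 'm) extension, ('k \<Rightarrow> 'k) \<times> ('x \<Rightarrow> 'x)) category)
           (Smod M) (action_obj M) action_arr"
proof
  show "conservative_functor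
           (smod_SExt M :: (('k, 'x, 'm) extension, ('k \<Rightarrow> 'k) \<times> ('x \<Rightarrow> 'x)) category)
           (Smod M) (action_obj M) action_arr"
    unfolding smod_SExt_def by (rule conservative_action_functor[OF assms]) blast
  show "conservative_functor
           (cc_SExt M :: (('k, 'x, 'm) extension, ('k \<Rightarrow> 'k) \<times> ('x \<Rightarrow> 'x)) category)
           (Smod M) (action_obj M) action_arr"
    unfolding cc_SExt_def
  proof (rule conservative_action_functor[OF assms])
    \<comment> \<open>The definition of this subcategory mentions only the kernel; that the induced
      action is a monoid action is derived from cancellation.\<close>
    fix E :: "('k, 'x, 'm) extension"
    assume E: "schreier_extension M E" and cancel: "comm_monoid_cancel (Ker E)"
    have comm: "comm_monoid (Ker E)"
      using cancel by (rule comm_monoid_cancel.axioms)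
    interpret comm_schreier M E
      using assms E comm by (simp add: comm_schreier_def comm_schreier_axioms_def schreier_def)
    show "comm_monoid (Ker E) \<and> ext_action M E \<in> monoid_hom M (End (Ker E))"
      using comm ext_action_hom[OF cancel] by blast
  qed
qed

end
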